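(* Let $X$ be a Banach space and let $E \subseteq X^*$ be a subset of its dual that is both $\sigma$-$w^*$-LRC and $w^*$-$K_\sigma$. Then the linear span $\operatorname{span}(E)$ is also both $\sigma$-$w^*$-LRC and $w^*$-$K_\sigma$.
   Context: Banach spaces are real. For a Banach space $X$, a subset $E \subseteq X^*$ is called $w^*$-LRC if for every $f \in E$ there is a $w^*$-open set $U \subseteq X^*$ with $f \in U$ such that the norm closure of $E \cap U$ is norm-compact. It is $\sigma$-$w^*$-LRC if it is a countable union of $w^*$-LRC sets. It is $w^*$-$K_\sigma$ if it is a countable union of $w^*$-compact sets. $\operatorname{span}(E)$ denotes the (algebraic, not closed) linear span. *)

theory Defs
  imports "HOL-Analysis.Analysis"
begin

text \<open>The dual of a real Banach space \<open>'a\<close> is \<open>'a \<Rightarrow>\<^sub>L real\<close>, whose type-class topology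
  (hence \<open>closure\<close> and \<open>compact\<close>) is that of the operator norm. For scalar-valued operators the
  strong operator topology, i.e. the topology of pointwise convergence on \<open>'a\<close>, is the
  \<open>w\<^sup>*\<close>-topology.\<close>

abbreviation weak_star_topology :: "('a::real_normed_vector \<Rightarrow>\<^sub>L real) topology" where
  "weak_star_topology \<equiv> strong_operator_topology"

definition weak_star_LRC :: "('a::real_normed_vector \<Rightarrow>\<^sub>L real) set \<Rightarrow> bool" where
  "weak_star_LRC E \<longleftrightarrow>
     (\<forall>f\<in>E. \<exists>U. openin weak_star_topology U \<and> f \<in> U \<and> compact (closure (E \<inter> U)))"

definition sigma_weak_star_LRC :: "('a::real_normed_vector \<Rightarrow>\<^sub>L real) set \<Rightarrow> bool" where
  "sigma_weak_star_LRC E \<longleftrightarrow>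
     (\<exists>\<A>. countable \<A> \<and> (\<forall>A\<in>\<A>. weak_star_LRC A) \<and> E = \<Union>\<A>)"

definition weak_star_K_sigma :: "('a::real_normed_vector \<Rightarrow>\<^sub>L real) set \<Rightarrow> bool" where
  "weak_star_K_sigma E \<longleftrightarrow>
     (\<exists>\<K>. countable \<K> \<and> (\<forall>K\<in>\<K>. compactin weak_star_topology K) \<and> E = \<Union>\<K>)"

end

theory Submission
  imports Defs
begin

text \<open>The class of sets that are both \<open>\<sigma>\<close>-\<open>w\<^sup>*\<close>-LRC and \<open>w\<^sup>*\<close>-\<open>K\<^sub>\<sigma>\<close> is closed under countable
  unions, and \<open>span E\<close> is the union of the sets \<open>S\<^sub>0 = {0}\<close>,
  \<open>S\<^sub>n\<^sub>+\<^sub>1 = {f + t g | f \<in> S\<^sub>n, g \<in> E, t \<in> \<real>}\<close>. Everything therefore reduces to the sets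
  \<open>{f + t g | f \<in> K, g \<in> L, \<bar>t\<bar> \<le> n}\<close> with \<open>K\<close>, \<open>L\<close> both \<open>w\<^sup>*\<close>-compact and \<open>\<sigma>\<close>-\<open>w\<^sup>*\<close>-LRC.
  Such a set is a \<open>w\<^sup>*\<close>-continuous image \<open>\<phi>(X)\<close> of the compact space
  \<open>X = K \<times> L \<times> [-n, n]\<close>, so it is \<open>w\<^sup>*\<close>-compact.

  The delicate point is the LRC decomposition of \<open>\<phi>(X)\<close>: the image of a product \<open>A \<times> B \<times> [-n, n]\<close>
  of LRC pieces need not be LRC, because infinitely many points of the product that lie far
  apart may have nearby images. Compactness of the fibres of \<open>\<phi>\<close> rescues the argument.
  Every LRC set is contained in an LRC set of the form \<open>C \<inter> W\<close> with \<open>C\<close> closed and \<open>W\<close> open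
  (\<open>weak_star_LRC_locally_closed\<close>), so \<open>X\<close> is covered by countably many pieces \<open>C\<^sub>i \<inter> W\<^sub>i\<close> with
  locally relatively norm compact image. A maximality argument (\<open>finite_stage_of_cover\<close>) shows that for each
  \<open>y \<in> \<phi>(X)\<close> there are finitely many indices \<open>I\<close> and an index \<open>k\<close> such that, after
  removing the open sets \<open>W\<^sub>i\<close>, \<open>i \<in> I\<close>, from \<open>X\<close>, the rest of the fibre of \<open>y\<close> meets \<open>C\<^sub>k\<close> and
  lies inside \<open>W\<^sub>k\<close>. There are only countably many pairs \<open>(I, k)\<close>. The points \<open>y\<close> that belong
  to one pair form an LRC set: the closed set \<open>M\<close> of the points of \<open>C\<^sub>k\<close> outside the \<open>W\<^sub>i\<close>,
  \<open>i \<in> I\<close>, does not depend on \<open>y\<close>, the part of the fibre in \<open>M\<close> is a compact subset of the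
  single piece \<open>C\<^sub>k \<inter> W\<^sub>k\<close>, and since \<open>\<phi>\<close> is a closed map, fibres of nearby points have their
  part in \<open>M\<close> close to it (\<open>sigma_weak_star_LRC_compact_image\<close>).\<close>

section \<open>The weak-star topology\<close>

lemma Hausdorff_space_weak_star:
  "Hausdorff_space (weak_star_topology :: ('a::real_normed_vector \<Rightarrow>\<^sub>L real) topology)"
  unfolding Hausdorff_space_def
proof (intro allI impI, elim conjE)
  fix f g :: "'a \<Rightarrow>\<^sub>L real"
  assume "f \<noteq> g"
  then obtain x where x: "blinfun_apply f x \<noteq> blinfun_apply g x"
    using blinfun_eqI by blast
  then obtain U V where UV: "open U" "open V" "blinfun_apply f x \<in> U" "blinfun_apply g x \<in> V"
      "U \<inter> V = {}"
    using hausdorff[OF x] by blast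
  have pre: "openin weak_star_topology {h :: 'a \<Rightarrow>\<^sub>L real. blinfun_apply h x \<in> S}" if "open S" for S
    using strong_operator_topology_basis[of "{()}" "\<lambda>_. S" "\<lambda>_. x"] that by simp
  show "\<exists>U V. openin weak_star_topology U \<and> openin weak_star_topology V \<and> f \<in> U \<and> g \<in> V
      \<and> disjnt U V"
    using UV pre[OF UV(1)] pre[OF UV(2)]
    by (intro exI[of _ "{h. blinfun_apply h x \<in> U}"] exI[of _ "{h. blinfun_apply h x \<in> V}"])
      (auto simp: disjnt_def)
qed

lemma closedin_weak_star_of_compact:
  fixes K :: "('a::real_normed_vector \<Rightarrow>\<^sub>L real) set"
  assumes "compact K"
  shows "closedin weak_star_topology K"
proof -
  have "compactin weak_star_topology ((\<lambda>f. f) ` K)"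
    using assms strong_operator_topology_weaker_than_euclidean
    by (intro image_compactin[of euclidean]) auto
  then show ?thesis
    using compactin_imp_closedin Hausdorff_space_weak_star by auto
qed

lemma compact_closure_mono:
  fixes S :: "'a::t2_space set"
  assumes "compact (closure T)" "S \<subseteq> T"
  shows "compact (closure S)"
proof -
  have "compact (closure T \<inter> closure S)"
    using assms(1) by (intro compact_Int_closed) auto
  then show ?thesis
    using closure_mono[OF assms(2)] by (simp add: Int_absorb1)
qed

lemma continuous_map_weak_star_add_scaled:
  assumes "continuous_map X weak_star_topology f" "continuous_map X weak_star_topology g"
    and "continuous_map X euclideanreal t"
  shows "continuous_map X weak_star_topology (\<lambda>x. f x + t x *\<^sub>R g x)"
  using assms unfolding continuous_on_strong_operator_topo_iff_coordinatewise
    blinfun.add_left blinfun.scaleR_left real_scaleR_def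
  by (intro allI continuous_map_add continuous_map_real_mult) auto

section \<open>Locally relatively compact sets\<close>

lemma weak_star_LRC_subset:
  assumes "weak_star_LRC A" "B \<subseteq> A"
  shows "weak_star_LRC B"
  unfolding weak_star_LRC_def
proof
  fix f assume "f \<in> B"
  then obtain U where "openin weak_star_topology U" "f \<in> U" "compact (closure (A \<inter> U))"
    using assms unfolding weak_star_LRC_def by blast
  moreover have "compact (closure (B \<inter> U))"
    using calculation(3) assms(2) by (elim compact_closure_mono) auto
  ultimately show "\<exists>U. openin weak_star_topology U \<and> f \<in> U \<and> compact (closure (B \<inter> U))"
    by blast
qed

lemma sigma_weak_star_LRC_subset:
  assumes "sigma_weak_star_LRC E" "F \<subseteq> E"
  shows "sigma_weak_star_LRC F"
proof -
  obtain \<A> where "countable \<A>" "\<forall>A\<in>\<A>. weak_star_LRC A" "E = \<Union>\<A>"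
    using assms(1) unfolding sigma_weak_star_LRC_def by blast
  then show ?thesis
    unfolding sigma_weak_star_LRC_def using assms(2)
    by (intro exI[of _ "(\<lambda>A. A \<inter> F) ` \<A>"])
      (auto intro: weak_star_LRC_subset[of _ "_ \<inter> F"])
qed

lemma sigma_weak_star_LRC_UN:
  assumes "countable J" "\<And>j. j \<in> J \<Longrightarrow> sigma_weak_star_LRC (E j)"
  shows "sigma_weak_star_LRC (\<Union>j\<in>J. E j)"
proof -
  obtain \<A> where "\<And>j. j \<in> J \<Longrightarrow> countable (\<A> j) \<and> (\<forall>A\<in>\<A> j. weak_star_LRC A) \<and> E j = \<Union>(\<A> j)"
    using assms(2) unfolding sigma_weak_star_LRC_def by metis
  then show ?thesis
    unfolding sigma_weak_star_LRC_def using assms(1)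
    by (intro exI[of _ "\<Union>j\<in>J. \<A> j"]) auto
qed

lemma weak_star_K_sigma_UN:
  assumes "countable J" "\<And>j. j \<in> J \<Longrightarrow> weak_star_K_sigma (E j)"
  shows "weak_star_K_sigma (\<Union>j\<in>J. E j)"
proof -
  obtain \<K> where "\<And>j. j \<in> J \<Longrightarrow>
      countable (\<K> j) \<and> (\<forall>K\<in>\<K> j. compactin weak_star_topology K) \<and> E j = \<Union>(\<K> j)"
    using assms(2) unfolding weak_star_K_sigma_def by metis
  then show ?thesis
    unfolding weak_star_K_sigma_def using assms(1)
    by (intro exI[of _ "\<Union>j\<in>J. \<K> j"]) auto
qed

text \<open>If \<open>A \<inter> U\<close> is relatively norm compact, then its norm closure is already \<open>w\<^sup>*\<close>-closed, so
  passing to the \<open>w\<^sup>*\<close>-closure of \<open>A\<close> adds nothing harmful inside \<open>U\<close>. Hence \<open>W\<close> may be taken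
  to be the union of all such \<open>U\<close>.\<close>

lemma weak_star_LRC_locally_closed:
  assumes "weak_star_LRC A"
  obtains C W where "closedin weak_star_topology C" "openin weak_star_topology W"
    "A \<subseteq> C \<inter> W" "weak_star_LRC (C \<inter> W)"
proof -
  define \<U> where "\<U> = {U. openin weak_star_topology U \<and> compact (closure (A \<inter> U))}"
  define C where "C = weak_star_topology closure_of A"
  have AC: "A \<subseteq> C"
    unfolding C_def by (simp add: closure_of_subset strong_operator_topology_topspace)
  have "weak_star_LRC (C \<inter> \<Union>\<U>)"
    unfolding weak_star_LRC_def
  proof
    fix f assume "f \<in> C \<inter> \<Union>\<U>"
    then obtain U where U: "U \<in> \<U>" "f \<in> U" by blast
    have "(C \<inter> \<Union>\<U>) \<inter> U \<subseteq> weak_star_topology closure_of (U \<inter> A)"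
      using openin_Int_closure_of_subset[of weak_star_topology U A] U
      unfolding C_def \<U>_def by blast
    also have "\<dots> \<subseteq> closure (A \<inter> U)"
      using U closure_subset[of "A \<inter> U"] unfolding \<U>_def
      by (intro closure_of_minimal closedin_weak_star_of_compact) auto
    finally have sub: "(C \<inter> \<Union>\<U>) \<inter> U \<subseteq> closure (A \<inter> U)" .
    have "compact (closure (closure (A \<inter> U)))"
      using U unfolding \<U>_def by simp
    then have "compact (closure ((C \<inter> \<Union>\<U>) \<inter> U))"
      using sub by (rule compact_closure_mono)
    then show "\<exists>U. openin weak_star_topology U \<and> f \<in> U
        \<and> compact (closure ((C \<inter> \<Union>\<U>) \<inter> U))"
      using U unfolding \<U>_def by blast
  qed
  moreover have "A \<subseteq> C \<inter> \<Union>\<U>"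
    using assms AC unfolding weak_star_LRC_def \<U>_def by blast
  moreover have "openin weak_star_topology (\<Union>\<U>)"
    unfolding \<U>_def by (intro openin_Union) auto
  moreover have "closedin weak_star_topology C"
    unfolding C_def by (rule closedin_closure_of)
  ultimately show thesis
    by (intro that)
qed

section \<open>Continuous images of compact spaces\<close>

text \<open>A maximal index set \<open>J\<close> whose sets \<open>W\<^sub>i\<close> fail to cover the compact set \<open>G\<close> leaves out a
  point \<open>x \<in> C\<^sub>k \<inter> W\<^sub>k\<close>. By maximality \<open>W\<^sub>k\<close> covers what \<open>J\<close> leaves, and compactness cuts \<open>J\<close>
  down to a finite set.\<close>

lemma finite_stage_of_cover:
  assumes G: "compactin X G" "G \<noteq> {}"
    and W: "\<And>i. i \<in> N \<Longrightarrow> openin X (W i)"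
    and cover: "G \<subseteq> (\<Union>i\<in>N. C i \<inter> W i)"
  obtains I k where "finite I" "I \<subseteq> N" "k \<in> N"
    "G \<inter> (C k - (\<Union>i\<in>I. W i)) \<noteq> {}" "G - (\<Union>i\<in>I. W i) \<subseteq> W k"
proof -
  have finite_subcover: "\<exists>I. finite I \<and> I \<subseteq> J \<and> G \<subseteq> (\<Union>i\<in>I. W i)"
    if "J \<subseteq> N" "G \<subseteq> (\<Union>i\<in>J. W i)" for J
  proof -
    have "\<exists>\<F>. finite \<F> \<and> \<F> \<subseteq> W ` J \<and> G \<subseteq> \<Union>\<F>"
      using that W by (intro compactinD[OF G(1)]) auto
    then show ?thesis
      by (metis finite_subset_image)
  qed
  define \<J> where "\<J> = {J. J \<subseteq> N \<and> \<not> G \<subseteq> (\<Union>i\<in>J. W i)}"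
  have "\<exists>J\<in>\<J>. \<forall>J'\<in>\<J>. J \<subseteq> J' \<longrightarrow> J' = J"
  proof (rule subset_Zorn_nonempty)
    show "\<J> \<noteq> {}"
      using G(2) unfolding \<J>_def by blast
    fix \<C> assume \<C>: "\<C> \<noteq> {}" "subset.chain \<J> \<C>"
    then have sub: "\<C> \<subseteq> \<J>"
      by (simp add: subset.chain_def)
    then have "\<Union>\<C> \<subseteq> N"
      unfolding \<J>_def by blast
    moreover have "\<not> G \<subseteq> (\<Union>i\<in>\<Union>\<C>. W i)"
    proof
      assume "G \<subseteq> (\<Union>i\<in>\<Union>\<C>. W i)"
      then obtain I where I: "finite I" "I \<subseteq> \<Union>\<C>" "G \<subseteq> (\<Union>i\<in>I. W i)"
        using finite_subcover[OF \<open>\<Union>\<C> \<subseteq> N\<close>] by blast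
      then obtain J where "J \<in> \<C>" "I \<subseteq> J"
        using finite_subset_Union_chain \<C> by metis
      then show False
        using I(3) sub unfolding \<J>_def by blast
    qed
    ultimately show "\<Union>\<C> \<in> \<J>"
      unfolding \<J>_def by blast
  qed
  then obtain J where J: "J \<in> \<J>" and max: "\<And>J'. J' \<in> \<J> \<Longrightarrow> J \<subseteq> J' \<Longrightarrow> J' = J"
    by blast
  obtain x where x: "x \<in> G" "x \<notin> (\<Union>i\<in>J. W i)"
    using J unfolding \<J>_def by blast
  then obtain k where "k \<in> N" "x \<in> C k" "x \<in> W k"
    using cover by blast
  note xk = x this
  have "insert k J \<notin> \<J>"
  proof
    assume "insert k J \<in> \<J>"
    then have "k \<in> J"
      using max[of "insert k J"] by blast
    then show False
      using xk by blast
  qed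
  then have cov: "G \<subseteq> (\<Union>i\<in>insert k J. W i)" and sub: "insert k J \<subseteq> N"
    using J xk unfolding \<J>_def by auto
  obtain I where I: "finite I" "I \<subseteq> insert k J" "G \<subseteq> (\<Union>i\<in>I. W i)"
    using finite_subcover[OF sub cov] by blast
  show thesis
  proof (rule that[of "I - {k}" k])
    show "G \<inter> (C k - (\<Union>i\<in>I - {k}. W i)) \<noteq> {}"
      using xk I(2) by blast
    show "finite (I - {k})" "I - {k} \<subseteq> N" "k \<in> N"
      using I(1,2) sub by auto
    show "G - (\<Union>i\<in>I - {k}. W i) \<subseteq> W k"
      using I(3) by blast
  qed
qed

text \<open>The images of the pieces \<open>C\<^sub>i \<inter> W\<^sub>i\<close> need not be LRC, since a point of the image may also
  be the limit of images of points that stay away from its fibre within the piece. Therefore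
  \<open>\<phi>(X)\<close> is decomposed according to the stage \<open>(I, k)\<close> at which the fibre is caught inside a
  single piece; there, a compact part of the fibre is covered by finitely many of the given
  neighbourhoods, and closedness of \<open>\<phi>\<close> on the compact space \<open>X\<close> does the rest.\<close>

lemma sigma_weak_star_LRC_compact_image:
  fixes \<phi> :: "'b \<Rightarrow> 'a::real_normed_vector \<Rightarrow>\<^sub>L real"
  assumes X: "compact_space X" and \<phi>: "continuous_map X weak_star_topology \<phi>"
    and N: "countable N"
    and C: "\<And>i. i \<in> N \<Longrightarrow> closedin X (C i)"
    and W: "\<And>i. i \<in> N \<Longrightarrow> openin X (W i)"
    and cover: "topspace X \<subseteq> (\<Union>i\<in>N. C i \<inter> W i)"
    and loc: "\<And>i x. i \<in> N \<Longrightarrow> x \<in> C i \<inter> W i \<Longrightarrow>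
      \<exists>U. openin X U \<and> x \<in> U \<and> compact (closure (\<phi> ` (C i \<inter> W i \<inter> U)))"
  shows "sigma_weak_star_LRC (\<phi> ` topspace X)"
proof -
  define fib where "fib y = {x \<in> topspace X. \<phi> x \<in> {y}}" for y
  define L where "L = (\<lambda>(I, k). {y. fib y \<inter> (C k - (\<Union>i\<in>I. W i)) \<noteq> {}
      \<and> fib y - (\<Union>i\<in>I. W i) \<subseteq> W k})"
  define P where "P = {I. finite I \<and> I \<subseteq> N} \<times> N"
  have fib_compact: "compactin X (fib y)" for y
  proof -
    have "closedin weak_star_topology {y}"
      by (intro closedin_weak_star_of_compact) auto
    then have "closedin X (fib y)"
      unfolding fib_def by (rule closedin_continuous_map_preimage[OF \<phi>])
    then show ?thesis
      by (rule closedin_compact_space[OF X])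
  qed
  have LRC: "weak_star_LRC (L (I, k))" if I: "finite I" "I \<subseteq> N" and k: "k \<in> N" for I k
    unfolding weak_star_LRC_def
  proof
    fix y assume y: "y \<in> L (I, k)"
    define M where "M = C k - (\<Union>i\<in>I. W i)"
    have M: "closedin X M"
      unfolding M_def using C W I k by (intro closedin_diff openin_Union) auto
    have "compactin X (fib y \<inter> M)"
      using fib_compact M by (simp add: compact_Int_closedin)
    moreover have MW: "fib y \<inter> M \<subseteq> C k \<inter> W k"
      using y unfolding L_def M_def by auto
    define \<U> where "\<U> = {U. openin X U \<and> compact (closure (\<phi> ` (C k \<inter> W k \<inter> U)))}"
    have "fib y \<inter> M \<subseteq> \<Union>\<U>"
      using MW loc[OF k] unfolding \<U>_def by blast
    ultimately obtain \<F> where \<F>: "finite \<F>" "\<F> \<subseteq> \<U>" "fib y \<inter> M \<subseteq> \<Union>\<F>"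
      using compactinD[of X "fib y \<inter> M" \<U>] unfolding \<U>_def by auto
    have "compact (\<Union>U\<in>\<F>. closure (\<phi> ` (C k \<inter> W k \<inter> U)))"
      using \<F> unfolding \<U>_def by (intro compact_UN) auto
    then have cpt: "compact (closure (\<Union>U\<in>\<F>. closure (\<phi> ` (C k \<inter> W k \<inter> U))))"
      by (simp add: compact_imp_closed)
    \<comment> \<open>Points near \<open>y\<close> have no preimage in \<open>M\<close> outside the chosen neighbourhoods.\<close>
    define V where "V = topspace weak_star_topology - \<phi> ` (M - \<Union>\<F>)"
    have "closedin X (M - \<Union>\<F>)"
      using M \<F>(2) unfolding \<U>_def by (intro closedin_diff openin_Union) auto
    then have "compactin weak_star_topology (\<phi> ` (M - \<Union>\<F>))"
      using X \<phi> closedin_compact_space image_compactin by blast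
    then have "openin weak_star_topology V"
      unfolding V_def using Hausdorff_space_weak_star compactin_imp_closedin by blast
    moreover have "y \<in> V"
      using \<F>(3) closedin_subset[OF M] unfolding V_def fib_def
      by (auto simp: strong_operator_topology_topspace)
    moreover have "L (I, k) \<inter> V \<subseteq> (\<Union>U\<in>\<F>. closure (\<phi> ` (C k \<inter> W k \<inter> U)))"
    proof
      fix z assume z: "z \<in> L (I, k) \<inter> V"
      then obtain x where x: "x \<in> fib z" "x \<in> M"
        unfolding L_def M_def by auto
      then have "x \<in> W k" "x \<in> C k" "\<phi> x = z"
        using z unfolding L_def M_def fib_def by auto
      moreover have "x \<in> \<Union>\<F>"
        using z x \<open>\<phi> x = z\<close> unfolding V_def by auto
      ultimately show "z \<in> (\<Union>U\<in>\<F>. closure (\<phi> ` (C k \<inter> W k \<inter> U)))"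
        using closure_subset by fast
    qed
    then have "compact (closure (L (I, k) \<inter> V))"
      using cpt compact_closure_mono by blast
    ultimately show "\<exists>U. openin weak_star_topology U \<and> y \<in> U \<and> compact (closure (L (I, k) \<inter> U))"
      by blast
  qed
  have "\<phi> ` topspace X \<subseteq> (\<Union>p\<in>P. L p)"
  proof
    fix y assume "y \<in> \<phi> ` topspace X"
    then have ne: "fib y \<noteq> {}"
      unfolding fib_def by auto
    have cov: "fib y \<subseteq> (\<Union>i\<in>N. C i \<inter> W i)"
      using cover unfolding fib_def by auto
    obtain I k where "finite I" "I \<subseteq> N" "k \<in> N"
        "fib y \<inter> (C k - (\<Union>i\<in>I. W i)) \<noteq> {}" "fib y - (\<Union>i\<in>I. W i) \<subseteq> W k"
      by (rule finite_stage_of_cover[OF fib_compact ne W cov])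
    then have "(I, k) \<in> P" "y \<in> L (I, k)"
      unfolding P_def L_def by simp_all
    then show "y \<in> (\<Union>p\<in>P. L p)"
      by (rule UN_I)
  qed
  moreover have "sigma_weak_star_LRC (\<Union>p\<in>P. L p)"
    unfolding sigma_weak_star_LRC_def
  proof (intro exI[of _ "L ` P"] conjI ballI)
    show "countable (L ` P)"
      unfolding P_def using N by (intro countable_image countable_SIGMA countable_Collect_finite_subset)
  qed (use LRC in \<open>auto simp: P_def\<close>)
  ultimately show ?thesis
    using sigma_weak_star_LRC_subset by blast
qed

section \<open>Sums and scalar multiples\<close>

text \<open>Products of locally closed pieces cover \<open>K \<times> L \<times> T\<close>. Addition and scaling are norm
  continuous, so products of relatively norm compact sets have relatively norm compact image;
  the map \<open>(f, g, t) \<mapsto> f + t g\<close> is also jointly \<open>w\<^sup>*\<close>-continuous, so the result on compact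
  images applies.\<close>

lemma sigma_weak_star_LRC_add_scaled_compact:
  fixes K L :: "('a::real_normed_vector \<Rightarrow>\<^sub>L real) set"
  assumes K: "compactin weak_star_topology K" "sigma_weak_star_LRC K"
    and L: "compactin weak_star_topology L" "sigma_weak_star_LRC L"
    and T: "compact T"
  shows "sigma_weak_star_LRC ((\<lambda>(f, g, t). f + t *\<^sub>R g) ` (K \<times> L \<times> T))"
proof -
  define X where "X = prod_topology (subtopology weak_star_topology K)
      (prod_topology (subtopology weak_star_topology L) (subtopology euclideanreal T))"
  define \<phi> :: "('a \<Rightarrow>\<^sub>L real) \<times> ('a \<Rightarrow>\<^sub>L real) \<times> real \<Rightarrow> 'a \<Rightarrow>\<^sub>L real"
    where "\<phi> = (\<lambda>(f, g, t). f + t *\<^sub>R g)"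
  obtain \<A> where \<A>: "countable \<A>" "\<And>A. A \<in> \<A> \<Longrightarrow> weak_star_LRC A" "K = \<Union>\<A>"
    using K(2) unfolding sigma_weak_star_LRC_def by blast
  obtain \<B> where \<B>: "countable \<B>" "\<And>B. B \<in> \<B> \<Longrightarrow> weak_star_LRC B" "L = \<Union>\<B>"
    using L(2) unfolding sigma_weak_star_LRC_def by blast
  have "\<exists>C W. weak_star_LRC A \<longrightarrow> closedin weak_star_topology C \<and> openin weak_star_topology W \<and>
      A \<subseteq> C \<inter> W \<and> weak_star_LRC (C \<inter> W)" for A :: "('a \<Rightarrow>\<^sub>L real) set"
    using weak_star_LRC_locally_closed by metis
  then obtain C W :: "('a \<Rightarrow>\<^sub>L real) set \<Rightarrow> ('a \<Rightarrow>\<^sub>L real) set"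
    where CW: "\<And>A. weak_star_LRC A \<Longrightarrow>
      closedin weak_star_topology (C A) \<and> openin weak_star_topology (W A) \<and>
      A \<subseteq> C A \<inter> W A \<and> weak_star_LRC (C A \<inter> W A)"
    by metis
  define box where "box S = (\<lambda>(A, B). (K \<inter> S A) \<times> (L \<inter> S B) \<times> T)"
    for S :: "('a \<Rightarrow>\<^sub>L real) set \<Rightarrow> ('a \<Rightarrow>\<^sub>L real) set"
  have tsX: "topspace X = K \<times> L \<times> T"
    unfolding X_def by (simp add: strong_operator_topology_topspace)
  have "sigma_weak_star_LRC (\<phi> ` topspace X)"
  proof (rule sigma_weak_star_LRC_compact_image[where N = "\<A> \<times> \<B>"
        and C = "box C" and W = "box W"])
    show "compact_space X"
      unfolding X_def using K L T
      by (simp add: compact_space_prod_topology compact_space_subtopology)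
    have fst: "continuous_map X weak_star_topology fst"
      unfolding X_def by (metis continuous_map_fst continuous_map_into_fulltopology)
    have snd: "continuous_map X (prod_topology (subtopology weak_star_topology L)
        (subtopology euclideanreal T)) snd"
      unfolding X_def by (rule continuous_map_snd)
    have "continuous_map X weak_star_topology (\<lambda>x. fst (snd x))"
      using continuous_map_into_fulltopology[OF continuous_map_compose[OF snd continuous_map_fst]]
      by (simp add: o_def)
    moreover have "continuous_map X euclideanreal (\<lambda>x. snd (snd x))"
      using continuous_map_into_fulltopology[OF continuous_map_compose[OF snd continuous_map_snd]]
      by (simp add: o_def)
    ultimately show "continuous_map X weak_star_topology \<phi>"
      using continuous_map_weak_star_add_scaled[OF fst] unfolding \<phi>_def case_prod_beta by blast
    show "countable (\<A> \<times> \<B>)"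
      using \<A> \<B> by simp
    show "topspace X \<subseteq> (\<Union>i\<in>\<A> \<times> \<B>. box C i \<inter> box W i)"
    proof
      fix x assume "x \<in> topspace X"
      then obtain f g t where x: "x = (f, g, t)" "f \<in> K" "g \<in> L" "t \<in> T"
        unfolding tsX by blast
      then obtain A B where AB: "A \<in> \<A>" "B \<in> \<B>" "f \<in> A" "g \<in> B"
        using \<A>(3) \<B>(3) by blast
      then have "x \<in> box C (A, B) \<inter> box W (A, B)"
        using x CW[OF \<A>(2)[OF AB(1)]] CW[OF \<B>(2)[OF AB(2)]] unfolding box_def by auto
      then show "x \<in> (\<Union>i\<in>\<A> \<times> \<B>. box C i \<inter> box W i)"
        using AB by blast
    qed
  next
    fix i assume "i \<in> \<A> \<times> \<B>"
    then obtain A B where i: "i = (A, B)" "A \<in> \<A>" "B \<in> \<B>"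
      by blast
    note CWA = CW[OF \<A>(2)[OF i(2)]] and CWB = CW[OF \<B>(2)[OF i(3)]]
    show "closedin X (box C i)"
      using CWA CWB unfolding X_def i box_def
      by (auto simp: closedin_prod_Times_iff closedin_subtopology_Int_closed)
    have openin_box: "openin X ((K \<inter> U) \<times> (L \<inter> V) \<times> T)"
      if "openin weak_star_topology U" "openin weak_star_topology V" for U V
      using that unfolding X_def
      by (auto simp: openin_prod_Times_iff openin_subtopology_Int2)
    show "openin X (box W i)"
      using CWA CWB unfolding i box_def by (simp add: openin_box)
    fix x
    assume x: "x \<in> box C i \<inter> box W i"
    then obtain f g t where fgt: "x = (f, g, t)" "f \<in> K \<inter> C A \<inter> W A" "g \<in> L \<inter> C B \<inter> W B" "t \<in> T"
      unfolding i box_def by auto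
    obtain U where U: "openin weak_star_topology U" "f \<in> U" "compact (closure (C A \<inter> W A \<inter> U))"
      using CWA fgt unfolding weak_star_LRC_def by blast
    obtain V where V: "openin weak_star_topology V" "g \<in> V" "compact (closure (C B \<inter> W B \<inter> V))"
      using CWB fgt unfolding weak_star_LRC_def by blast
    define Q where "Q = closure (C A \<inter> W A \<inter> U) \<times> closure (C B \<inter> W B \<inter> V) \<times> T"
    have "compact (\<phi> ` Q)"
    proof (rule compact_continuous_image)
      show "compact Q"
        unfolding Q_def using U V T by (intro compact_Times)
      show "continuous_on Q \<phi>"
        unfolding \<phi>_def case_prod_beta by (intro continuous_intros)
    qed
    then have "compact (closure (\<phi> ` Q))"
      by (simp add: compact_imp_closed)
    moreover have "\<phi> ` (box C i \<inter> box W i \<inter> (K \<inter> U) \<times> (L \<inter> V) \<times> T) \<subseteq> \<phi> ` Q"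
      unfolding Q_def i box_def using closure_subset by (intro image_mono) fast
    ultimately have "compact (closure (\<phi> ` (box C i \<inter> box W i
        \<inter> (K \<inter> U) \<times> (L \<inter> V) \<times> T)))"
      by (rule compact_closure_mono)
    then show "\<exists>U. openin X U \<and> x \<in> U \<and>
        compact (closure (\<phi> ` (box C i \<inter> box W i \<inter> U)))"
      using openin_box[OF U(1) V(1)] U(2) V(2) fgt unfolding i box_def
      by (intro exI[of _ "(K \<inter> U) \<times> (L \<inter> V) \<times> T"]) auto
  qed
  then show ?thesis
    unfolding tsX \<phi>_def .
qed

lemma compactin_add_scaled:
  fixes K L :: "('a::real_normed_vector \<Rightarrow>\<^sub>L real) set"
  assumes K: "compactin weak_star_topology K" and L: "compactin weak_star_topology L"
    and T: "compact T"
  shows "compactin weak_star_topology ((\<lambda>(f, g, t). f + t *\<^sub>R g) ` (K \<times> L \<times> T))"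
proof (rule image_compactin)
  let ?X = "prod_topology weak_star_topology (prod_topology weak_star_topology euclideanreal)
    :: (('a \<Rightarrow>\<^sub>L real) \<times> ('a \<Rightarrow>\<^sub>L real) \<times> real) topology"
  show "compactin ?X (K \<times> L \<times> T)"
    using assms by (simp add: compactin_Times)
  show "continuous_map ?X weak_star_topology (\<lambda>(f, g, t). f + t *\<^sub>R g)"
    unfolding case_prod_beta
    by (intro continuous_map_weak_star_add_scaled continuous_map_fst
        continuous_map_fst_of[OF continuous_map_snd, unfolded o_def]
        continuous_map_snd_of[OF continuous_map_snd, unfolded o_def])
qed

lemma sigma_LRC_K_sigma_add_scaled:
  fixes E F :: "('a::real_normed_vector \<Rightarrow>\<^sub>L real) set"
  assumes E: "sigma_weak_star_LRC E" "weak_star_K_sigma E"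
    and F: "sigma_weak_star_LRC F" "weak_star_K_sigma F"
  shows "sigma_weak_star_LRC ((\<lambda>(f, g, t). f + t *\<^sub>R g) ` (E \<times> F \<times> UNIV))"
    and "weak_star_K_sigma ((\<lambda>(f, g, t). f + t *\<^sub>R g) ` (E \<times> F \<times> UNIV))"
proof -
  define \<phi> :: "('a \<Rightarrow>\<^sub>L real) \<times> ('a \<Rightarrow>\<^sub>L real) \<times> real \<Rightarrow> 'a \<Rightarrow>\<^sub>L real"
    where "\<phi> = (\<lambda>(f, g, t). f + t *\<^sub>R g)"
  obtain \<K> where \<K>: "countable \<K>" "\<And>K. K \<in> \<K> \<Longrightarrow> compactin weak_star_topology K" "E = \<Union>\<K>"
    using E(2) unfolding weak_star_K_sigma_def by blast
  obtain \<L> where \<L>: "countable \<L>" "\<And>L. L \<in> \<L> \<Longrightarrow> compactin weak_star_topology L" "F = \<Union>\<L>"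
    using F(2) unfolding weak_star_K_sigma_def by blast
  define J where "J = \<K> \<times> \<L> \<times> (UNIV :: nat set)"
  define R where "R = (\<lambda>(K, L, n). \<phi> ` (K \<times> L \<times> {- real n..real n}))"
  have J: "countable J"
    unfolding J_def using \<K> \<L> by simp
  have abs_bound: "\<exists>n. - real n \<le> t \<and> t \<le> real n" for t
  proof -
    obtain n where "\<bar>t\<bar> \<le> real n"
      using real_arch_simple by blast
    then show ?thesis
      by (intro exI[of _ n]) auto
  qed
  have eq: "\<phi> ` (E \<times> F \<times> UNIV) = (\<Union>j\<in>J. R j)"
  proof
    show "\<phi> ` (E \<times> F \<times> UNIV) \<subseteq> (\<Union>j\<in>J. R j)"
    proof
      fix h assume "h \<in> \<phi> ` (E \<times> F \<times> UNIV)"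
      then obtain K L f g t where *: "h = \<phi> (f, g, t)" "K \<in> \<K>" "L \<in> \<L>" "f \<in> K" "g \<in> L"
        unfolding \<K>(3) \<L>(3) by blast
      obtain n where "- real n \<le> t \<and> t \<le> real n"
        using abs_bound by blast
      then have "h \<in> R (K, L, n)" "(K, L, n) \<in> J"
        using * unfolding R_def J_def by auto
      then show "h \<in> (\<Union>j\<in>J. R j)"
        by blast
    qed
    show "(\<Union>j\<in>J. R j) \<subseteq> \<phi> ` (E \<times> F \<times> UNIV)"
      unfolding J_def R_def \<K>(3) \<L>(3) by auto
  qed
  have "sigma_weak_star_LRC (\<Union>j\<in>J. R j)"
  proof (rule sigma_weak_star_LRC_UN[OF J])
    fix j assume "j \<in> J"
    then obtain K L n where j: "j = (K, L, n)" "K \<in> \<K>" "L \<in> \<L>"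
      unfolding J_def by auto
    have "sigma_weak_star_LRC K" "sigma_weak_star_LRC L"
      using j(2,3) sigma_weak_star_LRC_subset[OF E(1), of K] sigma_weak_star_LRC_subset[OF F(1), of L]
      unfolding \<K>(3) \<L>(3) by (simp_all add: Union_upper)
    then show "sigma_weak_star_LRC (R j)"
      unfolding j R_def \<phi>_def prod.case
      by (intro sigma_weak_star_LRC_add_scaled_compact \<K>(2) \<L>(2) j) auto
  qed
  then show "sigma_weak_star_LRC ((\<lambda>(f, g, t). f + t *\<^sub>R g) ` (E \<times> F \<times> UNIV))"
    using eq unfolding \<phi>_def by simp
  have "compactin weak_star_topology (R j)" if "j \<in> J" for j
  proof -
    obtain K L n where j: "j = (K, L, n)" "K \<in> \<K>" "L \<in> \<L>"
      using \<open>j \<in> J\<close> unfolding J_def by auto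
    show ?thesis
      unfolding j R_def \<phi>_def prod.case
      by (intro compactin_add_scaled \<K>(2) \<L>(2) j compact_Icc)
  qed
  then have "weak_star_K_sigma (\<Union>j\<in>J. R j)"
    unfolding weak_star_K_sigma_def using J by (intro exI[of _ "R ` J"]) auto
  then show "weak_star_K_sigma ((\<lambda>(f, g, t). f + t *\<^sub>R g) ` (E \<times> F \<times> UNIV))"
    using eq unfolding \<phi>_def by simp
qed

section \<open>The linear span\<close>

theorem theorem2p3:
  fixes E :: "('a::banach \<Rightarrow>\<^sub>L real) set"
  assumes "sigma_weak_star_LRC E"
    and "weak_star_K_sigma E"
  shows "sigma_weak_star_LRC (span E) \<and> weak_star_K_sigma (span E)"
proof -
  define S where "S n = ((\<lambda>S. (\<lambda>(f, g, t). f + t *\<^sub>R g) ` (S \<times> E \<times> UNIV)) ^^ n) {0}" for n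
  have S_0: "S 0 = {0}" and S_Suc: "S (Suc n) = (\<lambda>(f, g, t). f + t *\<^sub>R g) ` (S n \<times> E \<times> UNIV)" for n
    unfolding S_def by auto
  have "sigma_weak_star_LRC (S n) \<and> weak_star_K_sigma (S n)" for n
  proof (induction n)
    case 0
    have "weak_star_LRC {0 :: 'a \<Rightarrow>\<^sub>L real}"
      unfolding weak_star_LRC_def
      by (auto intro!: exI[of _ UNIV] simp: strong_operator_topology_topspace
          openin_topspace[of weak_star_topology, unfolded strong_operator_topology_topspace])
    then have "sigma_weak_star_LRC (S 0)"
      unfolding S_0 sigma_weak_star_LRC_def by (intro exI[of _ "{{0}}"]) auto
    moreover have "weak_star_K_sigma (S 0)"
      unfolding S_0 weak_star_K_sigma_def
      by (intro exI[of _ "{{0}}"]) (auto simp: strong_operator_topology_topspace)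
    ultimately show ?case
      by blast
  next
    case (Suc n)
    then show ?case
      unfolding S_Suc using sigma_LRC_K_sigma_add_scaled assms by blast
  qed
  then have "sigma_weak_star_LRC (\<Union>n. S n)" "weak_star_K_sigma (\<Union>n. S n)"
    by (auto intro: sigma_weak_star_LRC_UN weak_star_K_sigma_UN)
  moreover have "span E = (\<Union>n. S n)"
  proof
    show "span E \<subseteq> (\<Union>n. S n)"
    proof
      fix h assume "h \<in> span E"
      then show "h \<in> (\<Union>n. S n)"
      proof (induction rule: span_induct_alt)
        case base
        then show ?case using S_0 by blast
      next
        case (step c g f)
        then obtain n where "f \<in> S n" by blast
        then have "c *\<^sub>R g + f \<in> S (Suc n)"
          unfolding S_Suc using step(1) by (intro image_eqI[of _ _ "(f, g, c)"]) auto
        then show ?case by blast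
      qed
    qed
    have "S n \<subseteq> span E" for n
    proof (induction n)
      case (Suc n)
      then show ?case
        unfolding S_Suc by (auto intro: span_add span_scale span_base)
    qed (simp add: S_0 span_zero)
    then show "(\<Union>n. S n) \<subseteq> span E"
      by blast
  qed
  ultimately show ?thesis
    by simp
qed

end
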